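(* For all positive integers $a$ and $k$, $C(a^k)=C(a)$.
   Context: For a word $u$ over the positive integers, $C(u)=\{w \mid uw\equiv wu\}$, where $w$ ranges over finite words over the positive integers and $\equiv$ is Knuth equivalence (equivalently, $P(uw)=P(wu)$ with $P$ the RSK insertion tableau). $a^k$ is the word consisting of $k$ copies of the letter $a$. *)

theory Defs
  imports Main
begin

text \<open>Elementary Knuth relations, with the convention for which Knuth classes are the fibres of
  the row-insertion tableau \<open>P\<close>; each may be applied inside a word, between arbitrary
  factors \<open>p\<close> and \<open>q\<close>.\<close>

inductive knuth_step :: "'a::linorder list \<Rightarrow> 'a list \<Rightarrow> bool" where
  yzx: "x < y \<Longrightarrow> y \<le> z \<Longrightarrow> knuth_step (p @ [y, z, x] @ q) (p @ [y, x, z] @ q)"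
| xzy: "x \<le> y \<Longrightarrow> y < z \<Longrightarrow> knuth_step (p @ [x, z, y] @ q) (p @ [z, x, y] @ q)"

definition knuth_equiv :: "'a::linorder list \<Rightarrow> 'a list \<Rightarrow> bool" (infix \<open>\<equiv>\<^sub>K\<close> 50) where
  "u \<equiv>\<^sub>K w \<longleftrightarrow> equivclp knuth_step u w"

text \<open>The relations only permute letters, so on words over the positive integers the equivalence
  closure taken over \<^typ>\<open>nat list\<close> agrees with the one taken over positive words only.\<close>

definition pos_words :: "nat list set" where
  "pos_words = lists {0<..}"

definition centralizer :: "nat list \<Rightarrow> nat list set" where
  "centralizer u = {w \<in> pos_words. u @ w \<equiv>\<^sub>K w @ u}"

end

theory Submission
  imports Defs "HOL-Library.Sublist" "HOL-Library.Multiset"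
begin

text \<open>A word \<open>w\<close> commutes with \<open>a\<^sup>k\<close> iff no weakly increasing subsequence of \<open>w\<close> is longer than the
  number of letters \<open>a\<close> in \<open>w\<close>, a condition that does not mention \<open>k\<close>. For necessity, restrict
  \<open>a\<^sup>k w \<equiv> w a\<^sup>k\<close> to the letters \<open>\<le> a\<close> and compare the longest weakly increasing subsequences, and
  likewise for the letters \<open>\<ge> a\<close>. For sufficiency, column insertion writes \<open>w \<equiv> c v\<close> with \<open>c\<close> strictly
  decreasing and every letter of \<open>v\<close> at least the last letter of \<open>c\<close>; the bound forces \<open>a\<close> to occur
  in \<open>c\<close>, hence \<open>a c \<equiv> c a\<close>, and it passes on to \<open>v\<close>.\<close>

section \<open>Knuth equivalence as a congruence\<close>

lemma knuth_equiv_refl: "u \<equiv>\<^sub>K u"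
  by (simp add: knuth_equiv_def)

lemma knuth_equiv_sym: "u \<equiv>\<^sub>K v \<Longrightarrow> v \<equiv>\<^sub>K u"
  by (simp add: knuth_equiv_def equivclp_sym)

lemma knuth_equiv_trans [trans]: "u \<equiv>\<^sub>K v \<Longrightarrow> v \<equiv>\<^sub>K w \<Longrightarrow> u \<equiv>\<^sub>K w"
  unfolding knuth_equiv_def by (rule equivclp_trans)

lemma knuth_step_imp_equiv: "knuth_step u v \<Longrightarrow> u \<equiv>\<^sub>K v"
  unfolding knuth_equiv_def by (rule r_into_equivclp)

text \<open>The equivalence closure follows steps in both directions, so each step has to preserve
  and reflect \<open>P\<close>.\<close>

lemma knuth_equiv_invariant:
  assumes "u \<equiv>\<^sub>K v" and "P u"
    and "\<And>x y. knuth_step x y \<Longrightarrow> P x \<longleftrightarrow> P y"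
  shows "P v"
  using assms(1) unfolding knuth_equiv_def
  by (induction rule: equivclp_induct) (use assms(2,3) in blast)+

lemma knuth_step_context: "knuth_step u v \<Longrightarrow> knuth_step (p @ u @ q) (p @ v @ q)"
proof (induction rule: knuth_step.induct)
  case (yzx x y z p' q')
  then show ?case using knuth_step.yzx[of x y z "p @ p'" "q' @ q"] by simp
next
  case (xzy x y z p' q')
  then show ?case using knuth_step.xzy[of x y z "p @ p'" "q' @ q"] by simp
qed

lemma knuth_equiv_context:
  assumes "u \<equiv>\<^sub>K v"
  shows "p @ u @ q \<equiv>\<^sub>K p @ v @ q"
  using assms(1) unfolding knuth_equiv_def
  by (induction rule: equivclp_induct)
    (auto dest: knuth_step_context intro: equivclp_into_equivclp)

lemma knuth_equiv_append_left: "u \<equiv>\<^sub>K v \<Longrightarrow> p @ u \<equiv>\<^sub>K p @ v"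
  using knuth_equiv_context[of u v p "[]"] by simp

lemma knuth_equiv_append_right: "u \<equiv>\<^sub>K v \<Longrightarrow> u @ q \<equiv>\<^sub>K v @ q"
  using knuth_equiv_context[of u v "[]" q] by simp

lemma knuth_equiv_mset:
  assumes "u \<equiv>\<^sub>K v"
  shows "mset u = mset v"
proof -
  have "knuth_step x y \<Longrightarrow> mset x = mset y" for x y :: "'a list"
    by (induction rule: knuth_step.induct) auto
  then show ?thesis
    using knuth_equiv_invariant[OF assms, of "\<lambda>x. mset u = mset x"] by simp
qed

section \<open>Restriction to an interval of letters\<close>

text \<open>Both relations only exchange the extreme letters \<open>x\<close> and \<open>z\<close>.
  If both survive the filter, so does \<open>y\<close> by convexity, and the step remains; if one is
  removed, the two filtered words coincide.\<close>

lemma knuth_step_filter: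
  fixes P :: "'a::linorder \<Rightarrow> bool"
  assumes "knuth_step u v"
    and convex: "\<And>x y z. P x \<Longrightarrow> P z \<Longrightarrow> x \<le> y \<Longrightarrow> y \<le> z \<Longrightarrow> P y"
  shows "filter P u \<equiv>\<^sub>K filter P v"
  using assms(1)
proof cases
  case (yzx x y z p q)
  show ?thesis
  proof (cases "P x \<and> P z")
    case True
    then have "P y" using convex[of x z y] yzx by simp
    then show ?thesis
      using True yzx knuth_step.yzx[of x y z "filter P p" "filter P q"]
      by (simp add: knuth_step_imp_equiv)
  next
    case False
    then show ?thesis using yzx by (auto simp: knuth_equiv_refl)
  qed
next
  case (xzy x y z p q)
  show ?thesis
  proof (cases "P x \<and> P z")
    case True
    then have "P y" using convex[of x z y] xzy by simp
    then show ?thesis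
      using True xzy knuth_step.xzy[of x y z "filter P p" "filter P q"]
      by (simp add: knuth_step_imp_equiv)
  next
    case False
    then show ?thesis using xzy by (auto simp: knuth_equiv_refl)
  qed
qed

lemma knuth_equiv_filter:
  fixes P :: "'a::linorder \<Rightarrow> bool"
  assumes "u \<equiv>\<^sub>K v"
    and "\<And>x y z. P x \<Longrightarrow> P z \<Longrightarrow> x \<le> y \<Longrightarrow> y \<le> z \<Longrightarrow> P y"
  shows "filter P u \<equiv>\<^sub>K filter P v"
  using assms(1)
proof (rule knuth_equiv_invariant)
  show "filter P u \<equiv>\<^sub>K filter P u" by (rule knuth_equiv_refl)
  show "filter P u \<equiv>\<^sub>K filter P x \<longleftrightarrow> filter P u \<equiv>\<^sub>K filter P y" if "knuth_step x y" for x y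
    using knuth_step_filter[OF that, of P] assms(2) knuth_equiv_trans knuth_equiv_sym by metis
qed

section \<open>Weakly increasing subsequences\<close>

text \<open>The largest such \<open>n\<close> is the length of the first row of the insertion
  tableau. A predicate in \<open>n\<close> lets invariance be stated length by length, without a
  maximum.\<close>

definition has_incr :: "nat \<Rightarrow> 'a::linorder list \<Rightarrow> bool" where
  "has_incr n w \<longleftrightarrow> (\<exists>s. subseq s w \<and> sorted s \<and> length s = n)"

text \<open>A subsequence is cut along the three factors and only its middle piece is exchanged. As
  the outer pieces are arbitrary, the replacement must fit into every sorted context of the original
  piece.\<close>

lemma has_incr_knuth_factor:
  assumes "has_incr n (p @ m @ q)"
    and factor: "\<And>s. subseq s m \<Longrightarrow> sorted s \<Longrightarrow>
      \<exists>t. subseq t m' \<and> length t = length s \<and> (\<forall>p q. sorted (p @ s @ q) \<longrightarrow> sorted (p @ t @ q))"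
  shows "has_incr n (p @ m' @ q)"
proof -
  obtain s where s: "subseq s (p @ m @ q)" "sorted s" "length s = n"
    using assms(1) by (auto simp: has_incr_def)
  obtain s1 s2 s3 where split: "s = s1 @ s2 @ s3" "subseq s1 p" "subseq s2 m" "subseq s3 q"
    using s(1) by (metis subseq_appendE)
  have "sorted s2" using s(2) split(1) by (simp add: sorted_append)
  then obtain t where t: "subseq t m'" "length t = length s2" "sorted (s1 @ t @ s3)"
    using factor[OF split(3)] s(2) split(1) by blast
  have "subseq (s1 @ t @ s3) (p @ m' @ q)"
    using split t by (intro list_emb_append_mono)
  then show ?thesis
    unfolding has_incr_def using split s(3) t by (intro exI[of _ "s1 @ t @ s3"]) simp
qed

lemma subseq_three:
  assumes "subseq s [a, b, c]"
  shows "s \<in> {[], [a], [b], [c], [a, b], [a, c], [b, c], [a, b, c]}"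
  using assms by (auto elim!: list_emb.cases)

text \<open>Of the sorted subsequences of the three letters, only \<open>[x, z]\<close> occurs on
  one side alone. Where it is lost, \<open>[y, z]\<close> replaces it in the first relation and
  \<open>[x, y]\<close> in the second; both fit into the same contexts because
  \<open>x \<le> y \<le> z\<close>.\<close>

lemma has_incr_knuth_step:
  assumes "knuth_step u v"
  shows "has_incr n u \<longleftrightarrow> has_incr n v"
  using assms
proof cases
  case (yzx x y z p q)
  have "has_incr n v" if "has_incr n u"
    using that unfolding yzx(1,2)
  proof (rule has_incr_knuth_factor)
    fix s assume "subseq s [y, z, x]" "sorted s"
    then have "s = [] \<or> s = [y] \<or> s = [z] \<or> s = [x] \<or> s = [y, z]"
      using yzx by (auto dest!: subseq_three)
    then have "subseq s [y, x, z]" by auto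
    then show "\<exists>t. subseq t [y, x, z] \<and> length t = length s \<and>
        (\<forall>p q. sorted (p @ s @ q) \<longrightarrow> sorted (p @ t @ q))" by blast
  qed
  moreover have "has_incr n u" if "has_incr n v"
    using that unfolding yzx(1,2)
  proof (rule has_incr_knuth_factor)
    fix s assume "subseq s [y, x, z]" "sorted s"
    then have "s \<in> {[], [y], [x], [z], [y, z]} \<or> s = [x, z]"
      using yzx by (auto dest!: subseq_three)
    then show "\<exists>t. subseq t [y, z, x] \<and> length t = length s \<and>
        (\<forall>p q. sorted (p @ s @ q) \<longrightarrow> sorted (p @ t @ q))"
    proof
      assume "s \<in> {[], [y], [x], [z], [y, z]}"
      then have "subseq s [y, z, x]" by auto
      then show ?thesis by blast
    next
      assume "s = [x, z]"
      then show ?thesis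
        using yzx by (intro exI[of _ "[y, z]"]) (auto simp: sorted_append intro: order_trans)
    qed
  qed
  ultimately show ?thesis by blast
next
  case (xzy x y z p q)
  have "has_incr n v" if "has_incr n u"
    using that unfolding xzy(1,2)
  proof (rule has_incr_knuth_factor)
    fix s assume "subseq s [x, z, y]" "sorted s"
    then have "s \<in> {[], [x], [z], [y], [x, y]} \<or> s = [x, z]"
      using xzy by (auto dest!: subseq_three)
    then show "\<exists>t. subseq t [z, x, y] \<and> length t = length s \<and>
        (\<forall>p q. sorted (p @ s @ q) \<longrightarrow> sorted (p @ t @ q))"
    proof
      assume "s \<in> {[], [x], [z], [y], [x, y]}"
      then have "subseq s [z, x, y]" by auto
      then show ?thesis by blast
    next
      assume "s = [x, z]"
      then show ?thesis
        using xzy by (intro exI[of _ "[x, y]"]) (auto simp: sorted_append intro: order_trans)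
    qed
  qed
  moreover have "has_incr n u" if "has_incr n v"
    using that unfolding xzy(1,2)
  proof (rule has_incr_knuth_factor)
    fix s assume "subseq s [z, x, y]" "sorted s"
    then have "s \<in> {[], [x], [z], [y], [x, y]}"
      using xzy by (auto dest!: subseq_three)
    then have "subseq s [x, z, y]" by auto
    then show "\<exists>t. subseq t [x, z, y] \<and> length t = length s \<and>
        (\<forall>p q. sorted (p @ s @ q) \<longrightarrow> sorted (p @ t @ q))" by blast
  qed
  ultimately show ?thesis by blast
qed

lemma has_incr_knuth_equiv: "u \<equiv>\<^sub>K v \<Longrightarrow> has_incr n u \<Longrightarrow> has_incr n v"
  by (erule knuth_equiv_invariant) (simp_all add: has_incr_knuth_step)

lemma has_incr_length: "has_incr n w \<Longrightarrow> n \<le> length w"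
  by (auto simp: has_incr_def dest: list_emb_length)

section \<open>Necessity: commuting bounds the increasing subsequences\<close>

lemma maximal_incr:
  obtains n where "has_incr n w" and "\<And>m. has_incr m w \<Longrightarrow> m \<le> n"
proof -
  have "has_incr 0 w" by (simp add: has_incr_def)
  then have "\<exists>n. has_incr n w \<and> (\<forall>m. has_incr m w \<longrightarrow> m \<le> n)"
    using Nat.ex_has_greatest_nat[of "\<lambda>n. has_incr n w" 0 "length w"]
    by (auto dest: has_incr_length)
  then show thesis using that by blast
qed

lemma subseq_set: "subseq s w \<Longrightarrow> set s \<subseteq> set w"
  by (induction rule: list_emb.induct) auto

lemma subseq_replicate: "subseq s (replicate k a) \<Longrightarrow> \<exists>i\<le>k. s = replicate i a"
  using list_emb_length subseq_set
  by (intro exI[of _ "length s"]) (fastforce intro!: replicate_eqI)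

lemma subseq_count_le: "subseq s w \<Longrightarrow> count (mset s) a \<le> count (mset w) a"
  by (induction rule: list_emb.induct) auto

lemma subseq_replicate_count: "subseq (replicate (count (mset w) a) a) w"
  by (induction w) auto

text \<open>A longest subsequence of \<open>w\<close>, followed by the block, has length
  \<open>N + k\<close>. In the other word a subsequence of that length must meet the leading block,
  since \<open>w\<close> alone allows only \<open>N\<close>; so whatever it takes from
  \<open>w\<close> is at least \<open>a\<close>, hence equal to \<open>a\<close>. Thus
  \<open>N + k\<close> is at most \<open>k\<close> plus the number of letters \<open>a\<close> in
  \<open>w\<close>.\<close>

lemma incr_bounded_atMost:
  assumes comm: "replicate k a @ w \<equiv>\<^sub>K w @ replicate k a" and "k > 0"
    and le: "\<forall>x\<in>set w. x \<le> a" and "has_incr n w"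
  shows "n \<le> count (mset w) a"
proof -
  obtain N where N: "has_incr N w" "\<And>m. has_incr m w \<Longrightarrow> m \<le> N"
    using maximal_incr by blast
  obtain s where s: "subseq s w" "sorted s" "length s = N"
    using N(1) by (auto simp: has_incr_def)
  have "subseq (s @ replicate k a) (w @ replicate k a)"
    using s(1) by (intro list_emb_append_mono) auto
  moreover have "sorted (s @ replicate k a)"
    using s(2) le subseq_set[OF s(1)] by (auto simp: sorted_append)
  ultimately have "has_incr (N + k) (w @ replicate k a)"
    unfolding has_incr_def using s(3) by (intro exI[of _ "s @ replicate k a"]) simp
  then have "has_incr (N + k) (replicate k a @ w)"
    using has_incr_knuth_equiv[OF knuth_equiv_sym[OF comm]] by blast
  then obtain t where t: "subseq t (replicate k a @ w)" "sorted t" "length t = N + k"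
    by (auto simp: has_incr_def)
  then obtain t1 t2 where t12: "t = t1 @ t2" "subseq t1 (replicate k a)" "subseq t2 w"
    by (metis subseq_appendE)
  obtain i where i: "i \<le> k" "t1 = replicate i a"
    using subseq_replicate[OF t12(2)] by blast
  have "i \<noteq> 0"
  proof
    assume "i = 0"
    then have "has_incr (N + k) w"
      using t t12 i by (auto simp: has_incr_def)
    then show False using N(2) \<open>k > 0\<close> by fastforce
  qed
  then have "\<forall>x\<in>set t2. a \<le> x"
    using t(2) unfolding t12(1) i(2) by (simp add: sorted_append)
  then have "\<forall>x\<in>set t2. x = a"
    using le subseq_set[OF t12(3)] by (meson antisym subsetD)
  then have "t2 = replicate (length t2) a" by (simp add: replicate_length_same)
  then have "length t2 \<le> count (mset w) a"
    using subseq_count_le[OF t12(3), of a] by (metis count_replicate_mset mset_replicate)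
  then show ?thesis using N(2)[OF assms(4)] t(3) t12 i by simp
qed

text \<open>Mirror image of \<open>incr_bounded_atMost\<close>: the block precedes the longest
  subsequence, and in the other word the final block forces the letters taken from \<open>w\<close>
  down to \<open>a\<close>.\<close>

lemma incr_bounded_atLeast:
  assumes comm: "replicate k a @ w \<equiv>\<^sub>K w @ replicate k a" and "k > 0"
    and ge: "\<forall>x\<in>set w. a \<le> x" and "has_incr n w"
  shows "n \<le> count (mset w) a"
proof -
  obtain N where N: "has_incr N w" "\<And>m. has_incr m w \<Longrightarrow> m \<le> N"
    using maximal_incr by blast
  obtain s where s: "subseq s w" "sorted s" "length s = N"
    using N(1) by (auto simp: has_incr_def)
  have "subseq (replicate k a @ s) (replicate k a @ w)"
    using s(1) by (intro list_emb_append_mono) auto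
  moreover have "sorted (replicate k a @ s)"
    using s(2) ge subseq_set[OF s(1)] by (auto simp: sorted_append)
  ultimately have "has_incr (N + k) (replicate k a @ w)"
    unfolding has_incr_def using s(3) by (intro exI[of _ "replicate k a @ s"]) simp
  then have "has_incr (N + k) (w @ replicate k a)"
    using has_incr_knuth_equiv[OF comm] by blast
  then obtain t where t: "subseq t (w @ replicate k a)" "sorted t" "length t = N + k"
    by (auto simp: has_incr_def)
  then obtain t1 t2 where t12: "t = t1 @ t2" "subseq t1 w" "subseq t2 (replicate k a)"
    by (metis subseq_appendE)
  obtain i where i: "i \<le> k" "t2 = replicate i a"
    using subseq_replicate[OF t12(3)] by blast
  have "i \<noteq> 0"
  proof
    assume "i = 0"
    then have "has_incr (N + k) w"
      using t t12 i by (auto simp: has_incr_def)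
    then show False using N(2) \<open>k > 0\<close> by fastforce
  qed
  then have "\<forall>x\<in>set t1. x \<le> a"
    using t(2) unfolding t12(1) i(2) by (simp add: sorted_append)
  then have "\<forall>x\<in>set t1. x = a"
    using ge subseq_set[OF t12(2)] by (meson antisym subsetD)
  then have "t1 = replicate (length t1) a" by (simp add: replicate_length_same)
  then have "length t1 \<le> count (mset w) a"
    using subseq_count_le[OF t12(2), of a] by (metis count_replicate_mset mset_replicate)
  then show ?thesis using N(2)[OF assms(4)] t(3) t12 i by simp
qed

lemma sorted_split:
  fixes a :: "'a::linorder"
  assumes "sorted s"
  obtains p q where "s = p @ q" "\<forall>x\<in>set p. x \<le> a" "\<forall>x\<in>set q. a < x"
proof -
  have "s = takeWhile (\<lambda>x. x \<le> a) s @ dropWhile (\<lambda>x. x \<le> a) s" by simp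
  moreover have "\<forall>x\<in>set (takeWhile (\<lambda>x. x \<le> a) s). x \<le> a" by (auto dest: set_takeWhileD)
  moreover have "\<forall>x\<in>set (dropWhile (\<lambda>x. x \<le> a) s). a < x"
    using assms by (induction s) (auto simp: not_le)
  ultimately show thesis by (rule that)
qed

lemma subseq_filter_same: "subseq s w \<Longrightarrow> \<forall>x\<in>set s. P x \<Longrightarrow> subseq s (filter P w)"
  using subseq_filter[of s w P] by (simp add: filter_id_conv)

text \<open>The subsequence is cut at the value \<open>a\<close> into \<open>p\<close> and
  \<open>q\<close>, and \<open>w\<close> is cut accordingly. Each half is padded with the letters
  \<open>a\<close> from the opposite part of \<open>w\<close>, so that the two one-sided bounds add
  up to the claim.\<close>

lemma commutes_imp_incr_bounded:
  assumes comm: "replicate k a @ w \<equiv>\<^sub>K w @ replicate k a" and "k > 0"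
    and "has_incr n w"
  shows "n \<le> count (mset w) a"
proof -
  obtain s where s: "subseq s w" "sorted s" "length s = n"
    using assms(3) by (auto simp: has_incr_def)
  obtain p q where pq: "s = p @ q" "\<forall>x\<in>set p. x \<le> a" "\<forall>x\<in>set q. a < x"
    using sorted_split[OF s(2)] by blast
  obtain w1 w2 where w: "w = w1 @ w2" "subseq p w1" "subseq q w2"
    using s(1) pq(1) by (metis list_emb_appendD)
  define c1 c2 where "c1 = count (mset w1) a" and "c2 = count (mset w2) a"
  have "replicate k a @ filter (\<lambda>x. x \<le> a) w \<equiv>\<^sub>K filter (\<lambda>x. x \<le> a) w @ replicate k a"
    using knuth_equiv_filter[OF comm, of "\<lambda>x. x \<le> a"] by (simp add: filter_replicate)
  \<comment> \<open>The letters \<open>a\<close> of \<open>w2\<close> stand to the right of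
    \<open>p\<close>; counting them turns the bound \<open>c1 + c2\<close> into
    \<open>length p \<le> c1\<close>.\<close>
  moreover have "has_incr (length p + c2) (filter (\<lambda>x. x \<le> a) w)"
  proof -
    have "subseq (p @ replicate c2 a) w"
      unfolding w(1) c2_def by (intro list_emb_append_mono w(2) subseq_replicate_count)
    moreover have "sorted (p @ replicate c2 a)"
      using pq s(2) by (auto simp: sorted_append)
    ultimately show ?thesis
      unfolding has_incr_def using pq(2)
      by (intro exI[of _ "p @ replicate c2 a"]) (auto intro!: subseq_filter_same)
  qed
  ultimately have "length p + c2 \<le> count (mset (filter (\<lambda>x. x \<le> a) w)) a"
    using \<open>k > 0\<close> by (intro incr_bounded_atMost[of k]) auto
  then have p: "length p \<le> c1" using w(1) by (simp add: c1_def c2_def)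
  have "replicate k a @ filter (\<lambda>x. a \<le> x) w \<equiv>\<^sub>K filter (\<lambda>x. a \<le> x) w @ replicate k a"
    using knuth_equiv_filter[OF comm, of "\<lambda>x. a \<le> x"] by (simp add: filter_replicate)
  \<comment> \<open>Symmetrically, the letters \<open>a\<close> of \<open>w1\<close> precede
    \<open>q\<close>, which leaves at most \<open>c2\<close> for \<open>q\<close>.\<close>
  moreover have "has_incr (c1 + length q) (filter (\<lambda>x. a \<le> x) w)"
  proof -
    have "subseq (replicate c1 a @ q) w"
      unfolding w(1) c1_def by (intro list_emb_append_mono w(3) subseq_replicate_count)
    moreover have "sorted (replicate c1 a @ q)"
      using pq s(2) by (auto simp: sorted_append)
    ultimately show ?thesis
      unfolding has_incr_def using pq(3)
      by (intro exI[of _ "replicate c1 a @ q"]) (auto intro: less_imp_le intro!: subseq_filter_same)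
  qed
  ultimately have "c1 + length q \<le> count (mset (filter (\<lambda>x. a \<le> x) w)) a"
    using \<open>k > 0\<close> by (intro incr_bounded_atLeast[of k]) auto
  then have "length q \<le> c2" using w(1) by (simp add: c1_def c2_def)
  with p show ?thesis using s(3) pq(1) w(1) by (simp add: c1_def c2_def)
qed

section \<open>Column insertion\<close>

abbreviation decreasing :: "'a::linorder list \<Rightarrow> bool" where
  "decreasing \<equiv> sorted_wrt (>)"

lemma decreasing_distinct: "decreasing c \<Longrightarrow> distinct c"
  by (induction c) auto

lemma knuth_equiv_descend:
  assumes "x \<le> y" "y < z"
  shows "[x, z, y] \<equiv>\<^sub>K [z, x, y]"
  using knuth_step.xzy[OF assms, of "[]" "[]"] by (simp add: knuth_step_imp_equiv)

text \<open>\<open>x\<close> passes the letters of \<open>p\<close> one by one. The letter that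
  follows the one being passed acts as the middle value of the relation; for the last letter of
  \<open>p\<close> this is \<open>y\<close>.\<close>

lemma knuth_move_left_past_larger:
  assumes "decreasing (p @ [y])" "x \<le> y"
  shows "[x] @ p @ [y] \<equiv>\<^sub>K p @ [x, y]"
  using assms
proof (induction p)
  case Nil
  then show ?case by (simp add: knuth_equiv_refl)
next
  case (Cons z p)
  have "[x] @ (z # p) @ [y] \<equiv>\<^sub>K [z, x] @ p @ [y]"
  proof -
    obtain b r where b: "p @ [y] = b # r" by (cases "p @ [y]") auto
    then have "b = y \<or> b \<in> set p" "y < z \<and> (\<forall>c\<in>set p. y < c \<and> c < z)"
      using Cons.prems by (cases p; force simp: sorted_wrt_append)+
    then have "x \<le> b" "b < z" using Cons.prems(2) by auto
    then have "[x, z, b] @ r \<equiv>\<^sub>K [z, x, b] @ r"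
      by (intro knuth_equiv_append_right knuth_equiv_descend)
    then show ?thesis using b by simp
  qed
  also have "[z, x] @ p @ [y] \<equiv>\<^sub>K (z # p) @ [x, y]"
    using knuth_equiv_append_left[OF Cons.IH, of "[z]"] Cons.prems by simp
  finally show ?case .
qed

text \<open>\<open>y\<close> passes the letters of \<open>q\<close> one by one, with the letter just
  before \<open>y\<close> as middle value. This is \<open>x\<close> at first and then the letter
  passed last, so the induction has to vary \<open>x\<close>.\<close>

lemma knuth_move_right_past_smaller:
  assumes "decreasing (y # q)" "x \<le> y" "\<forall>b\<in>set q. b < x"
  shows "[x, y] @ q \<equiv>\<^sub>K [x] @ q @ [y]"
  using assms
proof (induction q arbitrary: x)
  case Nil
  then show ?case by (simp add: knuth_equiv_refl)
next
  case (Cons b q)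
  have "[x, y] @ b # q \<equiv>\<^sub>K [x, b, y] @ q"
    using knuth_equiv_append_right[OF knuth_step_imp_equiv[OF knuth_step.yzx[of b x y "[]" "[]"]], of q]
      Cons.prems by simp
  also have "[x, b, y] @ q \<equiv>\<^sub>K [x] @ (b # q) @ [y]"
    using knuth_equiv_append_left[OF Cons.IH[of b], of "[x]"] Cons.prems by (simp add: less_imp_le)
  finally show ?case .
qed

text \<open>One bump of column insertion: \<open>x\<close> takes the place of \<open>y\<close>, the
  smallest letter of the column that is at least \<open>x\<close>, and \<open>y\<close> leaves on
  the right.\<close>

lemma knuth_column_bump:
  assumes "decreasing (p @ [y] @ q)" "x \<le> y" "\<forall>b\<in>set q. b < x"
  shows "[x] @ p @ [y] @ q \<equiv>\<^sub>K p @ [x] @ q @ [y]"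
proof -
  have "[x] @ p @ [y] @ q \<equiv>\<^sub>K p @ [x, y] @ q"
    using knuth_equiv_append_right[OF knuth_move_left_past_larger[of p y x], of q] assms
    by (simp add: sorted_wrt_append)
  also have "p @ [x, y] @ q \<equiv>\<^sub>K p @ [x] @ q @ [y]"
    using knuth_equiv_append_left[OF knuth_move_right_past_smaller[of y q x], of p] assms
    by (simp add: sorted_wrt_append)
  finally show ?thesis .
qed

text \<open>Inserting a letter that the column already contains bumps its own copy, so the column is
  unchanged.\<close>

lemma decreasing_commutes_member:
  assumes "decreasing c" "a \<in> set c"
  shows "[a] @ c \<equiv>\<^sub>K c @ [a]"
proof -
  obtain p q where c: "c = p @ a # q" using assms(2) by (auto simp: in_set_conv_decomp)
  then show ?thesis
    using knuth_column_bump[of p a q a] assms(1) by (simp add: sorted_wrt_append)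
qed

lemma decreasing_split:
  assumes "decreasing c"
  shows "c = filter (\<lambda>b. x \<le> b) c @ filter (\<lambda>b. b < x) c"
  using assms
proof (induction c)
  case (Cons b c)
  show ?case
  proof (cases "x \<le> b")
    case True
    then show ?thesis using Cons by auto
  next
    case False
    then have "\<forall>d\<in>set (b # c). d < x" using Cons.prems by auto
    then have "filter (\<lambda>b. b < x) (b # c) = b # c" "filter (\<lambda>b. x \<le> b) (b # c) = []"
      by (auto simp: filter_id_conv filter_empty_conv)
    then show ?thesis by simp
  qed
qed simp

text \<open>Inserting the letters of \<open>w\<close> from right to left builds the first column
  \<open>c @ [l]\<close> of the insertion tableau, with the ejected letters in \<open>v\<close>. Of
  the tableau conditions only \<open>l \<le> x\<close> is kept for \<open>v\<close>: it lets
  \<open>l\<close> be put before any increasing subsequence of \<open>v\<close>.\<close>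

lemma knuth_equiv_column_factor:
  assumes "w \<noteq> []"
  shows "\<exists>c l v. w \<equiv>\<^sub>K c @ [l] @ v \<and> decreasing (c @ [l]) \<and> (\<forall>x\<in>set v. l \<le> x)"
  using assms
proof (induction w)
  case (Cons x w)
  show ?case
  proof (cases "w = []")
    case True
    then show ?thesis
      by (intro exI[of _ "[]"] exI[of _ x]) (simp add: knuth_equiv_refl)
  next
    case False
    then obtain c l v where IH: "w \<equiv>\<^sub>K c @ [l] @ v" "decreasing (c @ [l])" "\<forall>x\<in>set v. l \<le> x"
      using Cons.IH by blast
    have w: "x # w \<equiv>\<^sub>K [x] @ c @ [l] @ v"
      using knuth_equiv_append_left[OF IH(1), of "[x]"] by simp
    define p q where "p = filter (\<lambda>b. x \<le> b) (c @ [l])" and "q = filter (\<lambda>b. b < x) (c @ [l])"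
    have split: "c @ [l] = p @ q" using decreasing_split[OF IH(2)] by (simp add: p_def q_def)
    have q: "\<forall>b\<in>set q. b < x" and p: "\<forall>b\<in>set p. x \<le> b" by (auto simp: p_def q_def)
    show ?thesis
    proof (cases p rule: rev_cases)
      \<comment> \<open>All column letters are smaller than \<open>x\<close>, so \<open>x\<close>
        extends the column at its front and nothing is ejected.\<close>
      case Nil
      then have "decreasing ((x # c) @ [l])" using split q IH(2) by auto
      moreover have "x # w \<equiv>\<^sub>K (x # c) @ [l] @ v" using w by simp
      ultimately show ?thesis using IH(3) by blast
    next
      case (snoc p' y)
      have dec: "decreasing (p' @ [y] @ q)" using IH(2) split snoc by simp
      have xy: "x \<le> y" using p snoc by simp
      have cl: "c @ l # v = p' @ y # q @ v"
        using arg_cong[OF split, of "\<lambda>d. d @ v"] snoc by simp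
      have "[x] @ c @ [l] @ v \<equiv>\<^sub>K (p' @ [x] @ q @ [y]) @ v"
        using knuth_equiv_append_right[OF knuth_column_bump[OF dec xy q], of v] by (simp add: cl)
      from knuth_equiv_trans[OF w this]
      have equiv: "x # w \<equiv>\<^sub>K (p' @ [x] @ q) @ [y] @ v" by simp
      have dec': "decreasing (p' @ [x] @ q)"
        using dec xy q by (fastforce simp: sorted_wrt_append)
      show ?thesis
      proof (cases q rule: rev_cases)
        \<comment> \<open>Here the bumped letter was \<open>l\<close> itself, and \<open>x\<close>
          becomes the new last letter of the column.\<close>
        case Nil
        then have "y = l" using split snoc by simp
        then have "\<forall>b\<in>set (y # v). x \<le> b" using xy IH(3) by auto
        then show ?thesis using equiv dec' Nil
          by (intro exI[of _ p'] exI[of _ x] exI[of _ "y # v"]) auto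
      next
        case (snoc q' b)
        then have "b = l" using split by (metis append_assoc last_snoc)
        then have "\<forall>d\<in>set (y # v). b \<le> d" using xy q IH(3) snoc by auto
        then show ?thesis using equiv dec' snoc
          by (intro exI[of _ "p' @ [x] @ q'"] exI[of _ b] exI[of _ "y # v"]) auto
      qed
    qed
  qed
qed simp

section \<open>Sufficiency: bounded increasing subsequences give commuting\<close>

lemma incr_bounded_imp_commutes:
  assumes "\<And>n. has_incr n w \<Longrightarrow> n \<le> count (mset w) a"
  shows "[a] @ w \<equiv>\<^sub>K w @ [a]"
  using assms
proof (induction w rule: length_induct)
  case (1 w)
  show ?case
  proof (cases "w = []")
    case True
    then show ?thesis by (simp add: knuth_equiv_refl)
  next
    case False
    then obtain c l v where w: "w \<equiv>\<^sub>K c @ [l] @ v" and dec: "decreasing (c @ [l])"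
      and v: "\<forall>x\<in>set v. l \<le> x"
      using knuth_equiv_column_factor by blast
    define d where "d = c @ [l]"
    have wd: "w \<equiv>\<^sub>K d @ v" using w by (simp add: d_def)
    have mset: "mset w = mset d + mset v" using knuth_equiv_mset[OF wd] by simp
    \<comment> \<open>The last letter \<open>l\<close> of the column extends every increasing
      subsequence of \<open>v\<close> by one.\<close>
    have incr: "n + 1 \<le> count (mset d) a + count (mset v) a" if n: "has_incr n v" for n
    proof -
      obtain s where s: "subseq s v" "sorted s" "length s = n"
        using n by (auto simp: has_incr_def)
      have "sorted (l # s)" using s(2) v subseq_set[OF s(1)] by auto
      moreover have "subseq (l # s) (d @ v)"
        using s(1) by (simp add: d_def list_emb_append2)
      ultimately have "has_incr (n + 1) (d @ v)"
        unfolding has_incr_def using s(3) by (intro exI[of _ "l # s"]) simp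
      then have "has_incr (n + 1) w" using has_incr_knuth_equiv knuth_equiv_sym wd by blast
      then show ?thesis using "1.prems" mset by fastforce
    qed
    have "has_incr (count (mset v) a) v"
      unfolding has_incr_def
      by (intro exI[of _ "replicate (count (mset v) a) a"]) (simp add: subseq_replicate_count)
    \<comment> \<open>Applied to the letters \<open>a\<close> of \<open>v\<close> themselves, the
      bound leaves room for the extra letter only if \<open>d\<close> contains an
      \<open>a\<close>.\<close>
    from incr[OF this] have "a \<in> set d"
      by (metis Suc_eq_plus1 add_0 count_mset_0_iff not_less_eq_eq order_refl)
    have "distinct d" unfolding d_def using dec by (rule decreasing_distinct)
    \<comment> \<open>Exactly one \<open>a\<close> lies in \<open>d\<close>, which cancels the
      \<open>+ 1\<close> in \<open>incr\<close>: the bound passes to the shorter word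
      \<open>v\<close>.\<close>
    then have "count (mset d) a = 1" using \<open>a \<in> set d\<close> by (simp add: distinct_count_atmost_1)
    then have "[a] @ v \<equiv>\<^sub>K v @ [a]"
      using "1.IH" incr mset mset_eq_length[of w "d @ v"] by (fastforce simp: d_def)
    have "[a] @ w \<equiv>\<^sub>K [a] @ d @ v" using wd by (rule knuth_equiv_append_left)
    also have "[a] @ d @ v \<equiv>\<^sub>K d @ [a] @ v"
      using knuth_equiv_append_right[OF decreasing_commutes_member, of d a v] dec \<open>a \<in> set d\<close>
      by (simp add: d_def)
    also have "d @ [a] @ v \<equiv>\<^sub>K d @ v @ [a]"
      using \<open>[a] @ v \<equiv>\<^sub>K v @ [a]\<close> by (rule knuth_equiv_append_left)
    also have "d @ v @ [a] \<equiv>\<^sub>K w @ [a]"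
      using knuth_equiv_append_right[OF knuth_equiv_sym[OF wd], of "[a]"] by simp
    finally show ?thesis .
  qed
qed

lemma replicate_commutes:
  assumes "[a] @ w \<equiv>\<^sub>K w @ [a]"
  shows "replicate k a @ w \<equiv>\<^sub>K w @ replicate k a"
proof (induction k)
  case 0
  then show ?case by (simp add: knuth_equiv_refl)
next
  case (Suc k)
  have "replicate (Suc k) a @ w \<equiv>\<^sub>K [a] @ w @ replicate k a"
    using knuth_equiv_append_left[OF Suc, of "[a]"] by simp
  also have "[a] @ w @ replicate k a \<equiv>\<^sub>K w @ replicate (Suc k) a"
    using knuth_equiv_append_right[OF assms, of "replicate k a"] by simp
  finally show ?case .
qed

theorem theorem4p2:
  fixes a k :: nat
  assumes "a > 0" and "k > 0"
  shows "centralizer (replicate k a) = centralizer [a]"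
proof -
  \<comment> \<open>From left to right the argument passes through the bound on increasing
    subsequences, which is free of \<open>k\<close>; conversely, the letters \<open>a\<close> are
    moved past \<open>w\<close> one at a time.\<close>
  have "replicate k a @ w \<equiv>\<^sub>K w @ replicate k a \<longleftrightarrow> [a] @ w \<equiv>\<^sub>K w @ [a]" for w
    using commutes_imp_incr_bounded[of k a w] incr_bounded_imp_commutes[of w a]
      replicate_commutes[of a w k] \<open>k > 0\<close> by blast
  then show ?thesis by (simp add: centralizer_def)
qed

end
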